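(* The algorithm PA-III is convergent: for the error $E_n^k=U(T_n)-U_n^k$ and every $k\ge0$, $$\max_{1\le j\le N}\|E_j^{k+1}\|\le \alpha^{k+1}\min\left\{\left(\frac{1-\beta^{N-1}}{1-\beta}\right)^{k+1},\binom{N-1}{k+1}\right\}\max_{1\le j\le N}\|E_j^0\|,$$ where $\alpha=\|P_{J_2}-P_1\|$ and $\beta=\|P_1\|$.
   Context: Let $h>0$, let $N_x\ge 3$ be an integer, and let $D_h=\frac1{h^2}\,\mathrm{tridiag}(1,-2,1)\in\mathbb{R}^{(N_x-2)\times(N_x-2)}$ be the discrete Dirichlet Laplacian (diagonal entries $-2/h^2$, sub- and superdiagonal entries $1/h^2$, all others $0$). Let $\epsilon>0$, $T>0$, integers $N\ge1$ and $J\ge2$, $\Delta T=T/N$, $\Delta t=\Delta T/J$, $T_n=n\Delta T$. $\|\cdot\|$ is the Euclidean norm on $\mathbb{R}^{N_x-2}$ and the induced matrix norm. For $i\in\{1,2\}$ set $$P_i=(I-i\Delta T D_h+\epsilon^2\Delta T D_h^2)^{-1}(I-i\Delta T D_h),\qquad P_{J_i}=\Big[\big(I-\tfrac{i\Delta T}{J}D_h+\epsilon^2\tfrac{\Delta T}{J}D_h^2\big)^{-1}\big(I-\tfrac{i\Delta T}{J}D_h\big)\Big]^J .$$ Parareal iteration: given a fine propagator $\mathcal F$ and a coarse propagator $\mathcal G$ (maps $\mathbb{R}^{N_x-2}\to\mathbb{R}^{N_x-2}$ advancing the solution from $T_n$ to $T_{n+1}$) and $u^0\in\mathbb{R}^{N_x-2}$,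 the initial guess is $U_0^0=u^0$, $U_{n+1}^0=\mathcal G(U_n^0)$, and for $k=0,1,2,\dots$ $$U_0^{k+1}=u^0,\qquad U_{n+1}^{k+1}=\mathcal G(U_n^{k+1})+\mathcal F(U_n^k)-\mathcal G(U_n^k),\quad 0\le n\le N-1.$$ The discrete fine solution is $U(T_0)=u^0$, $U(T_{n+1})=\mathcal F(U(T_n))$. PA-III (in the form analyzed): the Parareal iteration with $\mathcal F(U)=P_{J_2}U$ and $\mathcal G(U)=P_1U$. Here $\mathcal F$ consists of $J$ steps of size $\Delta t$ of the scheme $\frac{W^{n+1}-W^n}{\Delta t}=D_h\,\mathrm{diag}(W^n)^2W^{n}-3D_hW^n-\epsilon^2D_h^2W^{n+1}+2D_hW^{n+1}$ and $\mathcal G$ is one step of size $\Delta T$ (i.e. with $\Delta t$ replaced by $\Delta T$) of the scheme $\frac{W^{n+1}-W^n}{\Delta t}=D_h\,\mathrm{diag}(W^n)^2W^{n+1}-\epsilon^2D_h^2W^{n+1}-D_hW^n$, both for the Cahn-Hilliard equation and both with $\mathrm{diag}(W^n)^2$ replaced by $I$. Convention: $\binom{a}{b}=0$ if $b>a\ge 0$. *)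

theory Defs
  imports "HOL-Analysis.Analysis"
begin

text \<open>
  Vectors are indexed by a finite linearly ordered type, so that the neighbouring indices of a
  tridiagonal matrix make sense; \<open>index_pos i\<close> is the 0-based position of \<open>i\<close> in that order.
\<close>

definition index_pos :: "'n::{finite,linorder} \<Rightarrow> nat" where
  "index_pos i = card {l. l < i}"

definition dirichlet_laplacian :: "real \<Rightarrow> real^'n::{finite,linorder}^'n::{finite,linorder}" where
  "dirichlet_laplacian h =
     (\<chi> i j. if i = j then - 2 / h\<^sup>2
            else if index_pos j = index_pos i + 1 \<or> index_pos i = index_pos j + 1 then 1 / h\<^sup>2
            else 0)"

text \<open>On \<open>real^'n^'n\<close> the operations \<open>*\<close> and \<open>^\<close> are componentwise, hence a separate matrix power.\<close>

primrec matrix_pow :: "real^'n^'n \<Rightarrow> nat \<Rightarrow> real^'n^'n" where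
  "matrix_pow A 0 = mat 1"
| "matrix_pow A (Suc m) = A ** matrix_pow A m"

definition matrix_norm :: "real^'n^'n \<Rightarrow> real" where
  "matrix_norm A = onorm ((*v) A)"

text \<open>
  One step of size \<open>\<tau>\<close> of the linearised scheme
  \<open>(W' - W) / \<tau> = i D W' - \<epsilon>\<^sup>2 D\<^sup>2 W' - i D W\<close>, solved for \<open>W'\<close>.
  For \<open>i = 1\<close> this is the coarse scheme. For \<open>i = 2\<close> it is the fine scheme, where
  \<open>- 2 D W\<close> arises as \<open>D W - 3 D W\<close>.
\<close>

definition step_matrix ::
    "real \<Rightarrow> real \<Rightarrow> nat \<Rightarrow> real \<Rightarrow> real^'n::{finite,linorder}^'n::{finite,linorder}" where
  "step_matrix h \<epsilon> i \<tau> =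
     (let D = dirichlet_laplacian h
      in matrix_inv (mat 1 - (real i * \<tau>) *\<^sub>R D + (\<epsilon>\<^sup>2 * \<tau>) *\<^sub>R (D ** D))
           ** (mat 1 - (real i * \<tau>) *\<^sub>R D))"

definition P_mat :: "real \<Rightarrow> real \<Rightarrow> real \<Rightarrow> nat \<Rightarrow> real^'n::{finite,linorder}^'n::{finite,linorder}" where
  "P_mat h \<epsilon> \<Delta>T i = step_matrix h \<epsilon> i \<Delta>T"

definition PJ_mat :: "real \<Rightarrow> real \<Rightarrow> real \<Rightarrow> nat \<Rightarrow> nat \<Rightarrow> real^'n::{finite,linorder}^'n::{finite,linorder}" where
  "PJ_mat h \<epsilon> \<Delta>T J i = matrix_pow (step_matrix h \<epsilon> i (\<Delta>T / real J)) J"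

text \<open>
  \<open>parareal F G u0 k n\<close> is \<open>U\<^sub>n\<^sup>k\<close>. It is defined for all \<open>n\<close>; an iterate at time index \<open>n\<close> depends
  only on time indices \<open>\<le> n\<close>, so restricting to \<open>n \<le> N\<close> gives the iteration on \<open>N\<close> intervals.
\<close>

fun parareal :: "('v \<Rightarrow> 'v) \<Rightarrow> ('v \<Rightarrow> 'v) \<Rightarrow> 'v \<Rightarrow> nat \<Rightarrow> nat \<Rightarrow> 'v::ab_group_add" where
  "parareal F G u0 k 0 = u0"
| "parareal F G u0 0 (Suc n) = G (parareal F G u0 0 n)"
| "parareal F G u0 (Suc k) (Suc n) =
     G (parareal F G u0 (Suc k) n) + F (parareal F G u0 k n) - G (parareal F G u0 k n)"

fun fine_solution :: "('v \<Rightarrow> 'v) \<Rightarrow> 'v \<Rightarrow> nat \<Rightarrow> 'v" where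
  "fine_solution F u0 0 = u0"
| "fine_solution F u0 (Suc n) = F (fine_solution F u0 n)"

definition PA_III ::
    "real \<Rightarrow> real \<Rightarrow> real \<Rightarrow> nat \<Rightarrow> real^'n::{finite,linorder} \<Rightarrow> nat \<Rightarrow> nat \<Rightarrow> real^'n::{finite,linorder}" where
  "PA_III h \<epsilon> \<Delta>T J u0 = parareal (\<lambda>U. PJ_mat h \<epsilon> \<Delta>T J 2 *v U) (\<lambda>U. P_mat h \<epsilon> \<Delta>T 1 *v U) u0"

definition PA_III_error ::
    "real \<Rightarrow> real \<Rightarrow> real \<Rightarrow> nat \<Rightarrow> real^'n::{finite,linorder} \<Rightarrow> nat \<Rightarrow> nat \<Rightarrow> real^'n::{finite,linorder}" where
  "PA_III_error h \<epsilon> \<Delta>T J u0 k n =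
     fine_solution (\<lambda>U. PJ_mat h \<epsilon> \<Delta>T J 2 *v U) u0 n - PA_III h \<epsilon> \<Delta>T J u0 k n"

end

theory Submission
  imports Defs
begin

text \<open>
  Write \<open>F\<close> and \<open>G\<close> for the linear fine and coarse propagators. Subtracting the Parareal recursion
  from the one of the fine solution gives
  \<open>E\<^sub>n\<^sub>+\<^sub>1\<^sup>k\<^sup>+\<^sup>1 = G E\<^sub>n\<^sup>k\<^sup>+\<^sup>1 + (F - G) E\<^sub>n\<^sup>k\<close> with \<open>E\<^sub>0\<^sup>k = 0\<close>
  (lemma \<open>parareal_error_recursion\<close>). Taking norms leaves the scalar recursion
  \<open>a (k+1) (n+1) \<le> \<beta> * a (k+1) n + \<alpha> * a k n\<close>. Bounding \<open>a k\<close> by its maximum and summing the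
  geometric series in \<open>\<beta>\<close> gives the first bound; replacing \<open>\<beta>\<close> by \<open>1\<close> turns the recursion into
  Pascal's rule and gives the binomial bound. The binomial coefficient vanishes for \<open>k \<ge> N\<close>, so the
  iteration is exact after finitely many sweeps, hence convergent.

  Both bounds rest on \<open>\<beta> < 1\<close>, the contractivity of the coarse propagator. With
  \<open>A = - D\<close>, the vector \<open>y = P\<^sub>1 x\<close> solves \<open>(B + C) y = B x\<close>, where
  \<open>B = I + \<tau> A\<close> and \<open>C = \<epsilon>\<^sup>2 \<tau> A\<^sup>2\<close> commute. Writing \<open>y = B w\<close> gives \<open>x = y + C w\<close>, and
  \<open>y \<bullet> C w = \<epsilon>\<^sup>2 \<tau> (\<bar>A w\<bar>\<^sup>2 + \<tau> A w \<bullet> A (A w)) > 0\<close> because \<open>A\<close> is symmetric positive definite, so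
  \<open>\<bar>y\<bar> < \<bar>x\<bar>\<close> without any diagonalisation. Compactness of the unit sphere turns this into
  \<open>\<beta> < 1\<close>. Positive definiteness of \<open>A\<close> is summation by parts on the grid values extended by zero
  to the boundary points.
\<close>

section \<open>Definiteness of the discrete Dirichlet Laplacian\<close>

lemma index_pos_strict_mono: "i < j \<Longrightarrow> index_pos i < index_pos j"
  unfolding index_pos_def by (rule psubset_card_mono) auto

lemma inj_index_pos: "inj index_pos"
  by (rule injI) (metis index_pos_strict_mono less_irrefl linorder_cases)

lemma bij_betw_index_pos:
  "bij_betw (index_pos :: 'n::{finite,linorder} \<Rightarrow> nat) UNIV {..<CARD('n)}"
proof -
  have "index_pos i < CARD('n)" for i :: 'n
    unfolding index_pos_def by (rule psubset_card_mono) auto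
  then have "range (index_pos :: 'n \<Rightarrow> nat) \<subseteq> {..<CARD('n)}" by auto
  moreover have "card (range (index_pos :: 'n \<Rightarrow> nat)) = CARD('n)"
    using inj_index_pos by (rule card_image)
  ultimately show ?thesis
    by (simp add: bij_betw_def inj_index_pos card_subset_eq)
qed

text \<open>
  The grid function of \<open>v\<close> with its homogeneous Dirichlet values: the entries of \<open>v\<close> sit at the grid
  points \<open>1, \<dots>, CARD('n)\<close>, and all other grid points carry \<open>0\<close>. Each sum has at most one nonzero
  term; a sum avoids inverting \<open>index_pos\<close>.
\<close>
definition zero_extension :: "real^'n::{finite,linorder} \<Rightarrow> nat \<Rightarrow> real" where
  "zero_extension v k = (\<Sum>j\<in>UNIV. if index_pos j + 1 = k then v $ j else 0)"

lemma zero_extension_index_pos: "zero_extension v (Suc (index_pos i)) = v $ i"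
proof -
  have "zero_extension v (Suc (index_pos i)) = (\<Sum>j\<in>UNIV. if j = i then v $ j else 0)"
    unfolding zero_extension_def
    by (rule sum.cong) (auto dest: injD[OF inj_index_pos])
  then show ?thesis by simp
qed

lemma zero_extension_left: "zero_extension v 0 = 0"
  by (simp add: zero_extension_def)

lemma zero_extension_right:
  fixes v :: "real^'n::{finite,linorder}"
  shows "zero_extension v (Suc CARD('n)) = 0"
proof -
  have "index_pos j \<noteq> CARD('n)" for j :: 'n
    using bij_betwE[OF bij_betw_index_pos] by (metis UNIV_I lessThan_iff less_irrefl)
  then show ?thesis by (simp add: zero_extension_def)
qed

lemma dirichlet_laplacian_mult:
  fixes v :: "real^'n::{finite,linorder}" and i :: 'n
  defines "f \<equiv> zero_extension v" and "p \<equiv> index_pos i"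
  shows "(dirichlet_laplacian h *v v) $ i = (f p - 2 * f (p + 1) + f (p + 2)) / h\<^sup>2"
proof -
  have entry: "(dirichlet_laplacian h $ i $ j) * v $ j =
      ((if index_pos j + 1 = p then v $ j else 0) - 2 * (if index_pos j + 1 = p + 1 then v $ j else 0)
        + (if index_pos j + 1 = p + 2 then v $ j else 0)) / h\<^sup>2" for j
    using injD[OF inj_index_pos, of i j]
    by (auto simp: dirichlet_laplacian_def p_def)
  show ?thesis
    unfolding matrix_vector_mult_def f_def zero_extension_def vec_lambda_beta entry
    by (simp add: sum_divide_distrib[symmetric] sum.distrib sum_subtractf sum_distrib_left)
qed

text \<open>The boundary terms are kept so that the identity can be proved by induction on \<open>n\<close>.\<close>
lemma summation_by_parts_second_difference:
  fixes f :: "nat \<Rightarrow> real"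
  shows "(\<Sum>k<n. f (k + 1) * (f k - 2 * f (k + 1) + f (k + 2))) =
    f (n + 1) * (f (n + 1) - f n) - f 0 * (f 1 - f 0) - (\<Sum>k\<le>n. (f (k + 1) - f k)\<^sup>2)"
  by (induction n) (simp_all add: algebra_simps power2_eq_square)

text \<open>
  Summation by parts turns the quadratic form into minus the sum of squared differences of the zero
  extension. It vanishes only for a constant extension, and the boundary values force that constant
  to be \<open>0\<close>.
\<close>
lemma dirichlet_laplacian_negative_definite:
  fixes v :: "real^'n::{finite,linorder}"
  assumes "h > 0" and "v \<noteq> 0"
  shows "v \<bullet> (dirichlet_laplacian h *v v) < 0"
proof -
  define f where "f = zero_extension v"
  let ?n = "CARD('n)"
  let ?S = "\<Sum>k\<le>?n. (f (k + 1) - f k)\<^sup>2"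
  have "v \<bullet> (dirichlet_laplacian h *v v) =
      (\<Sum>i\<in>(UNIV :: 'n set). (\<lambda>k. f (k + 1) * (f k - 2 * f (k + 1) + f (k + 2)) / h\<^sup>2) (index_pos i))"
    by (simp add: inner_vec_def dirichlet_laplacian_mult f_def
        zero_extension_index_pos)
  also have "\<dots> = (\<Sum>k<?n. f (k + 1) * (f k - 2 * f (k + 1) + f (k + 2)) / h\<^sup>2)"
    by (rule sum.reindex_bij_betw[OF bij_betw_index_pos])
  also have "\<dots> = - ?S / h\<^sup>2"
    unfolding sum_divide_distrib[symmetric] summation_by_parts_second_difference
    by (simp add: f_def zero_extension_left zero_extension_right)
  finally have eq: "v \<bullet> (dirichlet_laplacian h *v v) = - ?S / h\<^sup>2" .
  have "?S \<noteq> 0"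
  proof
    assume "?S = 0"
    then have step: "f (k + 1) = f k" if "k \<le> ?n" for k
      using that by (subst (asm) sum_nonneg_eq_0_iff) auto
    \<comment> \<open>All differences vanish, so the left boundary value \<open>0\<close> propagates through the grid.\<close>
    have zero: "f k = 0" if "k \<le> ?n + 1" for k
      using that by (induction k) (use step in \<open>auto simp: f_def zero_extension_left\<close>)
    have "v $ i = 0" for i
    proof -
      have "index_pos i < ?n" using bij_betwE[OF bij_betw_index_pos] by auto
      then show ?thesis
        using zero[of "index_pos i + 1"] by (simp add: f_def zero_extension_index_pos)
    qed
    with \<open>v \<noteq> 0\<close> show False by (simp add: vec_eq_iff)
  qed
  moreover have "?S \<ge> 0" by (rule sum_nonneg) simp
  ultimately have "?S > 0" by linarith
  then show ?thesis using \<open>h > 0\<close> by (simp add: eq)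
qed

lemma transpose_dirichlet_laplacian: "transpose (dirichlet_laplacian h) = dirichlet_laplacian h"
  by (auto simp: transpose_def dirichlet_laplacian_def vec_eq_iff)

section \<open>Contractivity of the coarse propagator\<close>

lemma inner_symmetric_matrix:
  fixes D :: "real^'n^'n"
  assumes "transpose D = D"
  shows "(D *v x) \<bullet> y = x \<bullet> (D *v y)"
  using dot_lmul_matrix[of x D y] assms by (metis transpose_matrix_vector)

lemma matrix_inv_inverse:
  assumes "invertible A"
  shows matrix_inv_right: "A ** matrix_inv A = mat 1"
    and matrix_inv_left: "matrix_inv A ** A = mat 1"
proof -
  have "A ** matrix_inv A = mat 1 \<and> matrix_inv A ** A = mat 1"
    unfolding matrix_inv_def using assms unfolding invertible_def by (rule someI_ex)
  then show "A ** matrix_inv A = mat 1" and "matrix_inv A ** A = mat 1" by auto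
qed

lemma invertible_if_positive_definite:
  fixes M :: "real^'n^'n"
  assumes "\<And>x. x \<noteq> 0 \<Longrightarrow> x \<bullet> (M *v x) > 0"
  shows "invertible M"
proof -
  have "x = 0" if "M *v x = 0" for x
    using assms[of x] that by fastforce
  then show ?thesis
    by (simp add: invertible_left_inverse matrix_left_invertible_ker)
qed

text \<open>
  With \<open>B = I - a D\<close>, the result \<open>y\<close> of the step satisfies \<open>x = y + z\<close> with \<open>z = b B\<inverse> D\<^sup>2 y\<close>. Since \<open>D\<close>
  commutes with \<open>B\<close>, the substitution \<open>y = B w\<close> removes the inverse, \<open>z = b D\<^sup>2 w\<close>, and symmetry
  of \<open>D\<close> shows \<open>y \<bullet> z > 0\<close>; so \<open>x\<close> is longer than \<open>y\<close>.
\<close>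
lemma semi_implicit_step_decreases_norm:
  fixes D :: "real^'n^'n" and x :: "real^'n"
  assumes sym: "transpose D = D" and neg: "\<And>v. v \<noteq> 0 \<Longrightarrow> v \<bullet> (D *v v) < 0"
    and "a > 0" and "b > 0" and "x \<noteq> 0"
  shows "norm ((matrix_inv (mat 1 - a *\<^sub>R D + b *\<^sub>R (D ** D)) ** (mat 1 - a *\<^sub>R D)) *v x) < norm x"
    (is "norm ((matrix_inv ?M ** ?B) *v x) < _")
proof -
  have B: "?B *v v = v - a *\<^sub>R (D *v v)" for v
    by (simp add: matrix_vector_mult_diff_rdistrib scaleR_matrix_vector_assoc[symmetric])
  have M: "?M *v v = ?B *v v + b *\<^sub>R (D *v (D *v v))" for v
    by (simp add: matrix_vector_mult_add_rdistrib scaleR_matrix_vector_assoc[symmetric]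
        matrix_vector_mul_assoc)
  have B_pos: "v \<bullet> (?B *v v) > 0" if "v \<noteq> 0" for v
    using neg[OF that] that \<open>a > 0\<close>
    by (simp add: B inner_diff_right) (smt (verit) inner_gt_zero_iff mult_pos_neg)
  have "v \<bullet> (D *v (D *v v)) \<ge> 0" for v
    by (metis inner_ge_zero inner_symmetric_matrix[OF sym])
  then have "v \<bullet> (?M *v v) > 0" if "v \<noteq> 0" for v
    using B_pos[OF that] \<open>b > 0\<close> by (simp add: M inner_add_right add_pos_nonneg)
  then have "invertible ?M" by (rule invertible_if_positive_definite)
  have "invertible ?B" using B_pos by (rule invertible_if_positive_definite)
  define y where "y = (matrix_inv ?M ** ?B) *v x"
  have "?M *v y = (?M ** matrix_inv ?M) *v (?B *v x)"
    by (simp add: y_def matrix_vector_mul_assoc matrix_mul_assoc)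
  also have "\<dots> = ?B *v x" by (simp add: matrix_inv_right[OF \<open>invertible ?M\<close>])
  finally have My: "?M *v y = ?B *v x" .
  define w where "w = matrix_inv ?B *v y"
  have Bw: "?B *v w = y"
    by (simp add: w_def matrix_vector_mul_assoc matrix_inv_right[OF \<open>invertible ?B\<close>])
  define z where "z = b *\<^sub>R (D *v (D *v w))"
  \<comment> \<open>This is where \<open>B\<close> commuting with \<open>D\<close> enters.\<close>
  have "?B *v z = b *\<^sub>R (D *v (D *v (?B *v w)))"
    by (simp add: B z_def matrix_vector_mult_diff_distrib matrix_vector_mult_scaleR
        scaleR_diff_right scaleR_left_commute)
  then have "?B *v (y + z) = ?B *v x"
    using My by (simp add: M Bw matrix_vector_right_distrib)
  then have x: "x = y + z"
    by (metis \<open>invertible ?B\<close> matrix_inv_left matrix_vector_mul_assoc matrix_vector_mul_lid)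
  show ?thesis
  proof (cases "y = 0")
    case True
    then show ?thesis using \<open>x \<noteq> 0\<close> y_def by simp
  next
    case False
    let ?u = "D *v w"
    have "w \<noteq> 0" using False Bw by auto
    then have "?u \<noteq> 0" using neg[of w] by auto
    have "y \<bullet> z = b * (?u \<bullet> ?u - a * (?u \<bullet> (D *v ?u)))"
      using inner_symmetric_matrix[OF sym, of w ?u]
      by (simp add: Bw[symmetric] B z_def inner_diff_left)
    also have "\<dots> > 0"
      using neg[OF \<open>?u \<noteq> 0\<close>] \<open>?u \<noteq> 0\<close> \<open>a > 0\<close> \<open>b > 0\<close>
      by (intro mult_pos_pos) (auto, smt (verit) inner_gt_zero_iff mult_pos_neg)
    finally have "y \<bullet> z > 0" .
    moreover have "(norm x)\<^sup>2 = (norm y)\<^sup>2 + 2 * (y \<bullet> z) + (norm z)\<^sup>2"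
      by (simp add: x power2_norm_eq_inner inner_add_left inner_add_right inner_commute)
    ultimately have "(norm y)\<^sup>2 < (norm x)\<^sup>2" using zero_le_power2[of "norm z"] by linarith
    then show ?thesis unfolding y_def[symmetric] using power2_less_imp_less norm_ge_zero by blast
  qed
qed

text \<open>
  A pointwise strict inequality only gives \<open>onorm f \<le> 1\<close> in general; in finite dimension the operator
  norm is attained on the compact unit sphere, which keeps the inequality strict.
\<close>
lemma onorm_less_1:
  fixes f :: "'a::euclidean_space \<Rightarrow> 'b::real_normed_vector"
  assumes "bounded_linear f" and less: "\<And>x. x \<noteq> 0 \<Longrightarrow> norm (f x) < norm x"
  shows "onorm f < 1"
proof -
  interpret bounded_linear f by fact
  have "continuous_on (sphere 0 1) (\<lambda>x. norm (f x))"
    by (intro continuous_intros linear_continuous_on assms)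
  then obtain x where x: "x \<in> sphere 0 1" and max: "\<And>y. y \<in> sphere 0 1 \<Longrightarrow> norm (f y) \<le> norm (f x)"
    using continuous_attains_sup[of "sphere (0::'a) 1" "\<lambda>x. norm (f x)"] by auto
  have "norm (f y) \<le> norm (f x) * norm y" for y
  proof (cases "y = 0")
    case False
    then have "norm (f (y /\<^sub>R norm y)) \<le> norm (f x)" by (intro max) simp
    then show ?thesis using False by (simp add: scaleR field_simps)
  qed (simp add: zero)
  then have "onorm f \<le> norm (f x)" by (intro onorm_bound) auto
  also have "\<dots> < 1" using less[of x] x by fastforce
  finally show ?thesis .
qed

lemma matrix_norm_coarse_less_1:
  assumes "h > 0" and "\<epsilon> > 0" and "\<tau> > 0"
  shows "matrix_norm (P_mat h \<epsilon> \<tau> 1 :: real^'n::{finite,linorder}^'n::{finite,linorder}) < 1"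
  unfolding matrix_norm_def P_mat_def step_matrix_def Let_def
  using assms
  by (intro onorm_less_1 matrix_vector_mul_bounded_linear semi_implicit_step_decreases_norm
      transpose_dirichlet_laplacian dirichlet_laplacian_negative_definite) auto

section \<open>Error recursion of the Parareal iteration\<close>

lemma parareal_error_recursion:
  fixes u0 :: "'v::real_vector"
  assumes "linear F" and "linear G"
  defines "e \<equiv> \<lambda>k n. fine_solution F u0 n - parareal F G u0 k n"
  shows "e (Suc k) (Suc n) = G (e (Suc k) n) + (F (e k n) - G (e k n))"
  by (simp add: e_def linear_diff[OF assms(1)] linear_diff[OF assms(2)])

lemma parareal_error_norm_recursion:
  fixes F G :: "'v::real_normed_vector \<Rightarrow> 'v" and u0 :: 'v
  assumes F: "bounded_linear F" and G: "bounded_linear G"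
  defines "e \<equiv> \<lambda>k n. fine_solution F u0 n - parareal F G u0 k n"
  shows "norm (e (Suc k) (Suc n)) \<le> onorm G * norm (e (Suc k) n) + onorm (\<lambda>x. F x - G x) * norm (e k n)"
proof -
  have "e (Suc k) (Suc n) = G (e (Suc k) n) + (F (e k n) - G (e k n))"
    unfolding e_def using F G by (intro parareal_error_recursion bounded_linear.linear)
  then show ?thesis
    using onorm[OF G, of "e (Suc k) n"] onorm[OF bounded_linear_sub[OF F G], of "e k n"]
    by (metis add_mono norm_triangle_le)
qed

section \<open>The scalar recursion\<close>

text \<open>
  For fixed \<open>k\<close> the recursion in \<open>n\<close> is a discrete Gronwall inequality whose source \<open>\<alpha> * a k n\<close> is
  bounded uniformly in \<open>n\<close>, so each increment of \<open>k\<close> costs a factor \<open>\<alpha>\<close> times a geometric sum.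
\<close>
lemma geometric_bound_of_recursion:
  fixes a :: "nat \<Rightarrow> nat \<Rightarrow> real"
  assumes rec: "\<And>k n. a (Suc k) (Suc n) \<le> \<beta> * a (Suc k) n + \<alpha> * a k n"
    and zero: "\<And>k. a k 0 = 0" and init: "\<And>j. j \<in> {1..N} \<Longrightarrow> a 0 j \<le> M"
    and "\<alpha> \<ge> 0" and "\<beta> \<ge> 0" and "M \<ge> 0" and "j \<in> {1..N}"
  shows "a k j \<le> (\<alpha> * (\<Sum>i<N - 1. \<beta> ^ i)) ^ k * M"
  using \<open>j \<in> {1..N}\<close>
proof (induction k arbitrary: j)
  case 0
  then show ?case using init by simp
next
  case (Suc k)
  let ?S = "\<lambda>n. \<Sum>i<n. \<beta> ^ i"
  let ?C = "(\<alpha> * ?S (N - 1)) ^ k * M"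
  have C: "?C \<ge> 0" using assms by (simp add: sum_nonneg)
  have partial: "a (Suc k) (Suc n) \<le> \<alpha> * ?S n * ?C" if "Suc n \<le> N" for n
    using that
  proof (induction n)
    case 0
    \<comment> \<open>The first value vanishes from \<open>k = 1\<close> on, so the sum at time index \<open>N\<close> has \<open>N - 1\<close> terms, not \<open>N\<close>.\<close>
    then show ?case using rec[of k 0] by (simp add: zero)
  next
    case (Suc n)
    have "a (Suc k) (Suc (Suc n)) \<le> \<beta> * a (Suc k) (Suc n) + \<alpha> * a k (Suc n)" by (rule rec)
    also have "\<dots> \<le> \<beta> * (\<alpha> * ?S n * ?C) + \<alpha> * ?C"
      using Suc Suc.prems \<open>\<alpha> \<ge> 0\<close> \<open>\<beta> \<ge> 0\<close> \<open>\<And>j. j \<in> {1..N} \<Longrightarrow> a k j \<le> ?C\<close>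
      by (intro add_mono mult_left_mono) auto
    also have "\<dots> = \<alpha> * (\<beta> * ?S n + 1) * ?C" by (simp add: algebra_simps)
    also have "\<beta> * ?S n + 1 = ?S (Suc n)"
      by (subst sum.lessThan_Suc_shift) (simp add: sum_distrib_left)
    finally show ?case .
  qed
  obtain n where n: "j = Suc n" "n \<le> N - 1" "Suc n \<le> N" using Suc.prems by (cases j) auto
  have "?S n \<le> ?S (N - 1)" using n \<open>\<beta> \<ge> 0\<close> by (intro sum_mono2) auto
  then have "\<alpha> * ?S n * ?C \<le> \<alpha> * ?S (N - 1) * ?C"
    using C \<open>\<alpha> \<ge> 0\<close> by (intro mult_right_mono mult_left_mono)
  with partial[OF n(3)] show ?case by (simp add: n(1) mult.assoc)
qed

text \<open>
  With \<open>\<beta>\<close> replaced by \<open>1\<close> and the powers of \<open>\<alpha>\<close> factored out, the recursion is Pascal's rule; the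
  zero initial values put the first nonzero column at time index \<open>1\<close>, hence the shift between \<open>n\<close> and
  \<open>Suc n\<close>.
\<close>
lemma binomial_bound_of_recursion:
  fixes a :: "nat \<Rightarrow> nat \<Rightarrow> real"
  assumes rec: "\<And>k n. a (Suc k) (Suc n) \<le> \<beta> * a (Suc k) n + \<alpha> * a k n"
    and zero: "\<And>k. a k 0 = 0" and init: "\<And>j. j \<in> {1..N} \<Longrightarrow> a 0 j \<le> M"
    and nonneg: "\<And>k n. a k n \<ge> 0"
    and "\<alpha> \<ge> 0" and "\<beta> \<le> 1" and "Suc n \<le> N"
  shows "a k (Suc n) \<le> \<alpha> ^ k * real (n choose k) * M"
  using \<open>Suc n \<le> N\<close>
proof (induction n arbitrary: k)
  case 0
  then show ?case
  proof (cases k)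
    case 0
    then show ?thesis using init[of 1] \<open>Suc 0 \<le> N\<close> by simp
  next
    case (Suc k')
    then show ?thesis using rec[of k' 0] by (simp add: zero)
  qed
next
  case (Suc n)
  show ?case
  proof (cases k)
    case 0
    then show ?thesis using init[of "Suc (Suc n)"] Suc.prems by simp
  next
    case [simp]: (Suc k')
    have "a (Suc k') (Suc (Suc n)) \<le> \<beta> * a (Suc k') (Suc n) + \<alpha> * a k' (Suc n)" by (rule rec)
    also have "\<dots> \<le> 1 * a (Suc k') (Suc n) + \<alpha> * a k' (Suc n)"
      using \<open>\<beta> \<le> 1\<close> nonneg by (intro add_mono mult_right_mono) auto
    also have "\<dots> \<le> \<alpha> ^ Suc k' * real (n choose Suc k') * M + \<alpha> * (\<alpha> ^ k' * real (n choose k') * M)"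
      using Suc.IH[of "Suc k'"] Suc.IH[of k'] Suc.prems \<open>\<alpha> \<ge> 0\<close>
      by (intro add_mono mult_left_mono) auto
    also have "\<dots> = \<alpha> ^ Suc k' * real (Suc n choose Suc k') * M" by (simp add: algebra_simps)
    finally show ?thesis by simp
  qed
qed

section \<open>Convergence of PA-III\<close>

theorem theorem3p11:
  fixes h \<epsilon> T \<Delta>T \<alpha> \<beta> :: real and Nx N J :: nat
    and u0 :: "real^'n::{finite,linorder}"
    and E :: "nat \<Rightarrow> nat \<Rightarrow> real^'n::{finite,linorder}"
  assumes "h > 0" and "\<epsilon> > 0" and "T > 0"
    and "Nx \<ge> 3" and "CARD('n) = Nx - 2"
    and "N \<ge> 1" and "J \<ge> 2"
    and "\<Delta>T = T / real N"
    and "\<alpha> = matrix_norm (PJ_mat h \<epsilon> \<Delta>T J 2 - P_mat h \<epsilon> \<Delta>T 1 :: real^'n::{finite,linorder}^'n::{finite,linorder})"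
    and "\<beta> = matrix_norm (P_mat h \<epsilon> \<Delta>T 1 :: real^'n::{finite,linorder}^'n::{finite,linorder})"
    and "E = PA_III_error h \<epsilon> \<Delta>T J u0"
  shows "(\<forall>n\<le>N. (\<lambda>k. E k n) \<longlonglongrightarrow> 0) \<and>
    (\<forall>k. (MAX j\<in>{1..N}. norm (E (k + 1) j)) \<le>
       \<alpha> ^ (k + 1)
         * min (((1 - \<beta> ^ (N - 1)) / (1 - \<beta>)) ^ (k + 1)) (real ((N - 1) choose (k + 1)))
         * (MAX j\<in>{1..N}. norm (E 0 j)))"
proof -
  define F where "F = (\<lambda>U :: real^'n::{finite,linorder}. PJ_mat h \<epsilon> \<Delta>T J 2 *v U)"
  define G where "G = (\<lambda>U :: real^'n::{finite,linorder}. P_mat h \<epsilon> \<Delta>T 1 *v U)"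
  define a where "a k n = norm (E k n)" for k n
  define M where "M = (MAX j\<in>{1..N}. a 0 j)"
  have "\<Delta>T > 0" using assms by simp
  have F: "bounded_linear F" and G: "bounded_linear G"
    unfolding F_def G_def by (rule matrix_vector_mul_bounded_linear)+
  have E: "E k n = fine_solution F u0 n - parareal F G u0 k n" for k n
    by (simp add: assms PA_III_error_def PA_III_def F_def G_def)
  have \<alpha>: "\<alpha> = onorm (\<lambda>x. F x - G x)"
    by (simp add: assms matrix_norm_def F_def G_def matrix_vector_mult_diff_rdistrib[symmetric])
  have \<beta>: "\<beta> = onorm G" by (simp add: assms matrix_norm_def G_def)
  have "\<alpha> \<ge> 0" unfolding \<alpha> by (intro onorm_pos_le bounded_linear_sub F G)
  have "\<beta> \<ge> 0" unfolding \<beta> by (intro onorm_pos_le G)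
  have "\<beta> < 1"
    using matrix_norm_coarse_less_1[OF \<open>h > 0\<close> \<open>\<epsilon> > 0\<close> \<open>\<Delta>T > 0\<close>] by (simp add: assms)
  have rec: "a (Suc k) (Suc n) \<le> \<beta> * a (Suc k) n + \<alpha> * a k n" for k n
    unfolding a_def E \<alpha> \<beta> by (rule parareal_error_norm_recursion[OF F G])
  have zero: "a k 0 = 0" for k by (cases k) (simp_all add: a_def E)
  have nonneg: "a k n \<ge> 0" for k n by (simp add: a_def)
  have init: "a 0 j \<le> M" if "j \<in> {1..N}" for j
    unfolding M_def using that by (intro Max_ge) auto
  have "M \<ge> 0" using nonneg[of 0 1] init[of 1] \<open>N \<ge> 1\<close> by force
  have binomial: "a k (Suc n) \<le> \<alpha> ^ k * real (n choose k) * M" if "Suc n \<le> N" for k n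
    using that \<open>\<beta> < 1\<close>
    by (intro binomial_bound_of_recursion[where N = N and \<beta> = \<beta>] rec zero init nonneg \<open>\<alpha> \<ge> 0\<close>) auto
  have "(\<lambda>k. E k n) \<longlonglongrightarrow> 0" if "n \<le> N" for n
  proof (rule tendsto_eventually, rule eventually_sequentiallyI)
    fix k assume "N \<le> k"
    have "a k n \<le> 0"
    proof (cases n)
      case (Suc m)
      then have "m < k" using that \<open>N \<le> k\<close> by simp
      then show ?thesis using binomial[of m k] Suc that by (simp add: binomial_eq_0)
    qed (simp add: zero)
    then show "E k n = 0" by (simp add: a_def)
  qed
  moreover have "(MAX j\<in>{1..N}. a (k + 1) j) \<le> \<alpha> ^ (k + 1)
      * min (((1 - \<beta> ^ (N - 1)) / (1 - \<beta>)) ^ (k + 1)) (real ((N - 1) choose (k + 1))) * M" for k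
  proof -
    have geometric_sum: "(\<Sum>i<N - 1. \<beta> ^ i) = (1 - \<beta> ^ (N - 1)) / (1 - \<beta>)"
      using \<open>\<beta> < 1\<close> by (simp add: sum_gp_strict)
    have bound: "a (k + 1) j \<le> \<alpha> ^ (k + 1)
      * min (((1 - \<beta> ^ (N - 1)) / (1 - \<beta>)) ^ (k + 1)) (real ((N - 1) choose (k + 1))) * M"
      if j: "j \<in> {1..N}" for j
    proof -
      have "a (k + 1) j \<le> (\<alpha> * (\<Sum>i<N - 1. \<beta> ^ i)) ^ (k + 1) * M"
        using geometric_bound_of_recursion[where a = a, OF rec zero init \<open>\<alpha> \<ge> 0\<close> \<open>\<beta> \<ge> 0\<close> \<open>M \<ge> 0\<close> j] .
      then have first: "a (k + 1) j \<le> \<alpha> ^ (k + 1) * ((1 - \<beta> ^ (N - 1)) / (1 - \<beta>)) ^ (k + 1) * M"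
        unfolding geometric_sum power_mult_distrib .
      obtain n where n: "j = Suc n" "n \<le> N - 1" "Suc n \<le> N" using j by (cases j) auto
      have "a (k + 1) j \<le> \<alpha> ^ (k + 1) * real (n choose (k + 1)) * M"
        unfolding n(1) using n(3) by (rule binomial)
      also have "\<dots> \<le> \<alpha> ^ (k + 1) * real ((N - 1) choose (k + 1)) * M"
        using n(2) \<open>\<alpha> \<ge> 0\<close> \<open>M \<ge> 0\<close> by (intro mult_right_mono mult_left_mono) (auto intro: binomial_right_mono)
      finally have second: "a (k + 1) j \<le> \<alpha> ^ (k + 1) * real ((N - 1) choose (k + 1)) * M" .
      show ?thesis using first second by (simp only: min_def split: if_split) blast
    qed
    show ?thesis using \<open>N \<ge> 1\<close> bound by (intro Max.boundedI) auto
  qed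
  ultimately show ?thesis unfolding a_def M_def by blast
qed

end
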